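(* Let $\tilde{y}^{(k)}=(y_1^{(k)},\dots,y_m^{(k)},y_{m+1}^{(k)})$, $k\ge0$, be the dual iterates generated by the extended Dykstra's algorithm described in the context, and for $k\ge 0$ define, for $\tilde y=(y_1,\dots,y_{m+1})\in X^{m+1}$, $$h^k(\tilde y)=\tfrac12\|d-(y_1+\cdots+y_{m+1})\|^2+\sum_{i=1}^m\delta^*(y_i,C_i)+\delta^*(y_{m+1},H_{m+1}^k).$$ Then the following hold: 1. For all $k\ge1$, $h^{k-1}(\tilde y^{(k-1)})\ge h^k(\tilde y^{(k)})+\frac12\sum_{i=1}^{m+1}\|y_i^{(k)}-y_i^{(k-1)}\|^2$. 2. The sum $\sum_{j=1}^\infty\sum_{i=1}^{m+1}\|y_i^{(j)}-y_i^{(j-1)}\|^2$ is finite.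
   Context: Let $X$ be a real Hilbert space, $d\in X$, $m\ge 1$, $C_1,\dots,C_m\subset X$ closed convex sets, and assume $C:=\bigcap_{i=1}^m C_i\neq\emptyset$. For a nonempty closed convex set $D$, $P_D$ denotes the projection onto $D$, and $\delta^*(y,D)=\sup_{x\in D}\langle y,x\rangle\in(-\infty,+\infty]$ is the support function. Extended Dykstra's algorithm: choose arbitrary $y_1^{(0)},\dots,y_m^{(0)}\in X$, and set $y_{m+1}^{(0)}=0$, $H_{m+1}^0=X$, $x_{m+1}^{(0)}=d-\sum_{i=1}^{m+1}y_i^{(0)}$. For $k=1,2,\dots$: - Set $x_0^{(k)}=x_{m+1}^{(k-1)}$. - For $i=1,\dots,m$ in order: $z_i^{(k)}=x_{i-1}^{(k)}+y_i^{(k-1)}$, $x_i^{(k)}=P_{C_i}(z_i^{(k)})$, $y_i^{(k)}=z_i^{(k)}-x_i^{(k)}$. - Choose any closed convex set $C_{m+1}^k\subset X$ with $C\subset C_{m+1}^k\subset H_{m+1}^{k-1}$. - Set $z_{m+1}^{(k)}=x_m^{(k)}+y_{m+1}^{(k-1)}$, $x_{m+1}^{(k)}=P_{C_{m+1}^k}(z_{m+1}^{(k)})$, $y_{m+1}^{(k)}=z_{m+1}^{(k)}-x_{m+1}^{(k)}$. - Set $H_{m+1}^k=\{x\in X:\langle y_{m+1}^{(k)},x-x_{m+1}^{(k)}\rangle\le 0\}$. *)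

theory Defs
  imports "HOL-Analysis.Analysis"
begin

text \<open>The library's \<^verbatim>\<open>closest_point\<close> is restricted to class \<^verbatim>\<open>heine_borel\<close>, i.e. to finite
  dimension, so the projection is defined here for arbitrary inner product spaces. The point is
  unique and exists when \<open>D\<close> is nonempty, closed and convex and the space is complete.\<close>

definition proj :: "'a::real_inner set \<Rightarrow> 'a \<Rightarrow> 'a" where
  "proj D z = (THE p. p \<in> D \<and> (\<forall>u\<in>D. dist z p \<le> dist z u))"

definition support_fun :: "'a::real_inner \<Rightarrow> 'a set \<Rightarrow> ereal" where
  "support_fun v D = (SUP u\<in>D. ereal (v \<bullet> u))"

text \<open>\<open>x k i\<close>, \<open>y k i\<close>, \<open>z k i\<close> stand for $x_i^{(k)}$, $y_i^{(k)}$, $z_i^{(k)}$; the values at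
  indices outside the algorithm's range are unconstrained and never used. \<open>K k\<close> is the chosen set
  $C_{m+1}^k$ (for $k \ge 1$) and \<open>H k\<close> is $H_{m+1}^k$. Since \<open>K\<close> is an arbitrary sequence, its
  members may depend on the earlier iterates.\<close>

locale extended_dykstra =
  fixes d :: "'a::{real_inner, complete_space}"
    and m :: nat
    and C :: "nat \<Rightarrow> 'a set"
    and K :: "nat \<Rightarrow> 'a set"
    and H :: "nat \<Rightarrow> 'a set"
    and x y z :: "nat \<Rightarrow> nat \<Rightarrow> 'a"
  assumes y_init: "y 0 (m + 1) = 0"
    and H_init: "H 0 = UNIV"
    and x_init: "x 0 (m + 1) = d - (\<Sum>i=1..m+1. y 0 i)"
    and x_start: "\<And>k. k \<ge> 1 \<Longrightarrow> x k 0 = x (k - 1) (m + 1)"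
    and z_step: "\<And>k i. k \<ge> 1 \<Longrightarrow> i \<in> {1..m} \<Longrightarrow> z k i = x k (i - 1) + y (k - 1) i"
    and x_step: "\<And>k i. k \<ge> 1 \<Longrightarrow> i \<in> {1..m} \<Longrightarrow> x k i = proj (C i) (z k i)"
    and y_step: "\<And>k i. k \<ge> 1 \<Longrightarrow> i \<in> {1..m} \<Longrightarrow> y k i = z k i - x k i"
    and K_closed: "\<And>k. k \<ge> 1 \<Longrightarrow> closed (K k)"
    and K_convex: "\<And>k. k \<ge> 1 \<Longrightarrow> convex (K k)"
    and K_lower: "\<And>k. k \<ge> 1 \<Longrightarrow> (\<Inter>i\<in>{1..m}. C i) \<subseteq> K k"
    and K_upper: "\<And>k. k \<ge> 1 \<Longrightarrow> K k \<subseteq> H (k - 1)"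
    and z_last: "\<And>k. k \<ge> 1 \<Longrightarrow> z k (m + 1) = x k m + y (k - 1) (m + 1)"
    and x_last: "\<And>k. k \<ge> 1 \<Longrightarrow> x k (m + 1) = proj (K k) (z k (m + 1))"
    and y_last: "\<And>k. k \<ge> 1 \<Longrightarrow> y k (m + 1) = z k (m + 1) - x k (m + 1)"
    and H_step: "\<And>k. k \<ge> 1 \<Longrightarrow> H k = {u. y k (m + 1) \<bullet> (u - x k (m + 1)) \<le> 0}"

text \<open>\<open>v\<close> encodes a tuple in $X^{m+1}$ by its values on \<open>{1..m+1}\<close>. The sums cannot
  meet \<open>\<infinity> + -\<infinity>\<close>, because the support function of a nonempty set is never \<open>-\<infinity>\<close>.\<close>

definition dual_obj :: "'a::real_inner \<Rightarrow> nat \<Rightarrow> (nat \<Rightarrow> 'a set) \<Rightarrow> 'a set \<Rightarrow> (nat \<Rightarrow> 'a) \<Rightarrow> ereal"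
  where "dual_obj d m C Hk v =
    ereal (1/2 * (norm (d - (\<Sum>i=1..m+1. v i)))\<^sup>2)
      + (\<Sum>i=1..m. support_fun (v i) (C i)) + support_fun (v (m + 1)) Hk"

end

theory Submission
  imports Defs
begin

text \<open>One pass of the algorithm is a block coordinate descent on the dual objective. Within pass \<open>k\<close>
  every inner step keeps \<open>x + y\<close>: \<open>x k (i - 1) + y (k - 1) i = x k i + y k i\<close>. Two things follow.

  First, the last primal iterate is always the residual \<open>d - (\<Sum>i=1..m+1. y k i)\<close>, so the quadratic
  part of the dual objective is \<open>1/2 * (norm (x k (m + 1)))\<^sup>2\<close>. Secondly, writing the previous
  iterate as \<open>x k i + (y k i - y (k - 1) i)\<close> and expanding its squared norm gives, for each \<open>i\<close>,
  an exact balance between the norms, the products \<open>y k i \<bullet> x k i\<close> and \<open>y (k - 1) i \<bullet> x k i\<close>, and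
  the squared dual step; over the pass the norms telescope (\<open>pass_balance\<close>).

  The products are tied to the support functions by the variational inequality of the projection:
  \<open>y k i\<close> is normal to the constraint set at \<open>x k i\<close>, so its support function there is
  exactly \<open>y k i \<bullet> x k i\<close>, while \<open>y (k - 1) i \<bullet> x k i\<close> is merely a lower bound for the support
  function of the old multiplier. For the last block the two support functions are
  taken over different sets. Normality makes \<open>x k (m + 1)\<close> a maximiser over the new halfspace
  \<open>H k\<close>, and \<open>K k \<subseteq> H (k - 1)\<close> makes the same point admissible for the old one. This yields the descent
  inequality.

  Summability follows since weak duality at a point of the intersection bounds the objective from
  below. The initial value may be infinite (the starting multipliers are arbitrary), but every
  support function is attained after one pass, so the sum telescopes from the first pass on.\<close>

section \<open>Projections in Hilbert space\<close>

text \<open>By the parallelogram law, points of \<open>D\<close> whose distance to \<open>z\<close> is nearly minimal are close to one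
  another, because their midpoint is in \<open>D\<close> and cannot be much nearer. So the nearly minimal
  points form nested closed sets of vanishing diameter, and completeness gives a common point.\<close>

lemma nearest_point_exists:
  fixes D :: "'a::{real_inner, complete_space} set"
  assumes "closed D" "convex D" "D \<noteq> {}"
  shows "\<exists>p\<in>D. \<forall>u\<in>D. dist z p \<le> dist z u"
proof -
  define r where "r = infdist z D"
  define S where "S n = {u \<in> D. (dist z u)\<^sup>2 \<le> r\<^sup>2 + inverse (real (Suc n))}" for n
  have r_le: "r \<le> dist z u" if "u \<in> D" for u
    unfolding r_def using that by (rule infdist_le)
  have r0: "0 \<le> r"
    unfolding r_def by (rule infdist_nonneg)
  have S_closed: "closed (S n)" for n
  proof -
    have "S n = D \<inter> {u. (dist z u)\<^sup>2 \<le> r\<^sup>2 + inverse (real (Suc n))}"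
      by (auto simp: S_def)
    then show ?thesis
      by (auto intro!: closed_Int assms(1) closed_Collect_le continuous_intros)
  qed
  have S_nonempty: "S n \<noteq> {}" for n
  proof -
    let ?s = "sqrt (r\<^sup>2 + inverse (real (Suc n)))"
    have "r < ?s"
      using r0 by (intro real_less_rsqrt) simp
    moreover have "r = (INF a\<in>D. dist z a)"
      using assms(3) by (simp add: r_def infdist_notempty)
    ultimately obtain u where u: "u \<in> D" "dist z u < ?s"
      using cINF_less_iff[of D "dist z" ?s] assms(3) by (auto intro: bdd_belowI[of _ 0])
    then have "(dist z u)\<^sup>2 \<le> ?s\<^sup>2"
      by (intro power_mono) auto
    also have "\<dots> = r\<^sup>2 + inverse (real (Suc n))"
      by simp
    finally show ?thesis
      using u by (auto simp: S_def)
  qed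
  have S_decreasing: "S n \<subseteq> S k" if "k \<le> n" for k n
  proof -
    have "inverse (real (Suc n)) \<le> inverse (real (Suc k))"
      using that by (intro le_imp_inverse_le) auto
    then show ?thesis
      unfolding S_def by (auto intro: order_trans)
  qed
  have S_small: "\<exists>n. \<forall>u\<in>S n. \<forall>v\<in>S n. dist u v < \<epsilon>" if "\<epsilon> > 0" for \<epsilon>
  proof -
    obtain n where n: "inverse (real (Suc n)) < \<epsilon>\<^sup>2 / 4"
      using reals_Archimedean[of "\<epsilon>\<^sup>2 / 4"] \<open>\<epsilon> > 0\<close> by auto
    have "dist u v < \<epsilon>" if u: "u \<in> S n" and v: "v \<in> S n" for u v
    proof -
      let ?w = "(1/2) *\<^sub>R u + (1/2) *\<^sub>R v"
      have "?w \<in> D"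
        using u v assms(2) by (intro convexD) (auto simp: S_def)
      then have "r\<^sup>2 \<le> (dist z ?w)\<^sup>2"
        using r_le r0 by (intro power_mono) auto
      moreover have "(dist u v)\<^sup>2 = 2 * (dist z u)\<^sup>2 + 2 * (dist z v)\<^sup>2 - 4 * (dist z ?w)\<^sup>2"
        by (simp add: dist_norm power2_norm_eq_inner algebra_simps inner_commute)
      ultimately have "(dist u v)\<^sup>2 \<le> 4 * inverse (real (Suc n))"
        using u v by (auto simp: S_def)
      also have "\<dots> < \<epsilon>\<^sup>2"
        using n by simp
      finally show ?thesis
        using \<open>\<epsilon> > 0\<close> by (simp add: power2_less_imp_less)
    qed
    then show ?thesis by blast
  qed
  obtain p where p: "\<And>n. p \<in> S n"
    using decreasing_closed_nest[OF S_closed S_nonempty S_decreasing S_small] by blast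
  have "(dist z p)\<^sup>2 \<le> r\<^sup>2"
  proof (rule field_le_epsilon)
    fix e :: real assume "e > 0"
    then obtain n where "inverse (real (Suc n)) < e"
      using reals_Archimedean by blast
    then show "(dist z p)\<^sup>2 \<le> r\<^sup>2 + e"
      using p[of n] by (auto simp: S_def)
  qed
  then have "dist z p \<le> r"
    using r0 power2_le_imp_le by blast
  moreover have "p \<in> D"
    using p by (simp add: S_def)
  ultimately show ?thesis
    using r_le by (meson order_trans)
qed

lemma
  fixes D :: "'a::{real_inner, complete_space} set"
  assumes "closed D" "convex D" "D \<noteq> {}"
  shows proj_in: "proj D z \<in> D"
    and proj_variational: "u \<in> D \<Longrightarrow> (z - proj D z) \<bullet> (u - proj D z) \<le> 0"
proof -
  have "\<exists>!p. p \<in> D \<and> (\<forall>u\<in>D. dist z p \<le> dist z u)"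
    using nearest_point_exists[OF assms] any_closest_point_unique[OF assms(2,1)] by metis
  then have p: "proj D z \<in> D \<and> (\<forall>u\<in>D. dist z (proj D z) \<le> dist z u)"
    unfolding proj_def by (rule theI')
  then show "proj D z \<in> D"
    by blast
  show "(z - proj D z) \<bullet> (u - proj D z) \<le> 0" if "u \<in> D"
    using any_closest_point_dot[OF assms(2,1)] p that by blast
qed

section \<open>Support functions\<close>

lemma support_fun_ge: "u \<in> D \<Longrightarrow> ereal (v \<bullet> u) \<le> support_fun v D"
  unfolding support_fun_def by (rule SUP_upper)

lemma support_fun_eq_at_normal_point:
  assumes "p \<in> D" "\<And>u. u \<in> D \<Longrightarrow> v \<bullet> (u - p) \<le> 0"
  shows "support_fun v D = ereal (v \<bullet> p)"
proof (rule antisym)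
  show "support_fun v D \<le> ereal (v \<bullet> p)"
    unfolding support_fun_def using assms(2) by (intro SUP_least) (simp add: inner_diff_right)
qed (rule support_fun_ge[OF assms(1)])

text \<open>Weak duality at a feasible point \<open>c\<close>: replacing the support functions by their values at \<open>c\<close>
  leaves \<open>1/2 * (norm s)\<^sup>2 + (d - s) \<bullet> c\<close>, where \<open>s\<close> is the residual; this is minimal at \<open>s = c\<close>.\<close>

lemma dual_obj_ge:
  assumes "\<And>i. i \<in> {1..m} \<Longrightarrow> c \<in> C i" "c \<in> D"
  shows "ereal (d \<bullet> c - 1/2 * (norm c)\<^sup>2) \<le> dual_obj d m C D v"
proof -
  let ?s = "d - (\<Sum>i=1..m+1. v i)"
  have "0 \<le> (norm (?s - c))\<^sup>2"
    by simp
  also have "(norm (?s - c))\<^sup>2 = (norm ?s)\<^sup>2 - 2 * (?s \<bullet> c) + (norm c)\<^sup>2"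
    by (simp only: power2_norm_eq_inner inner_diff_left inner_diff_right inner_commute)
       (simp add: algebra_simps)
  also have "?s \<bullet> c = d \<bullet> c - ((\<Sum>i=1..m. v i \<bullet> c) + v (m+1) \<bullet> c)"
    by (simp add: inner_diff_left inner_add_left inner_sum_left)
  finally have "ereal (d \<bullet> c - 1/2 * (norm c)\<^sup>2)
      \<le> ereal (1/2 * (norm ?s)\<^sup>2) + (\<Sum>i=1..m. ereal (v i \<bullet> c)) + ereal (v (m+1) \<bullet> c)"
    by simp
  also have "\<dots> \<le> dual_obj d m C D v"
    unfolding dual_obj_def using assms by (intro add_mono sum_mono support_fun_ge order_refl) auto
  finally show ?thesis .
qed

section \<open>The iteration\<close>

locale feasible_dykstra = extended_dykstra +
  assumes C_closed: "\<And>i. i \<in> {1..m} \<Longrightarrow> closed (C i)"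
    and C_convex: "\<And>i. i \<in> {1..m} \<Longrightarrow> convex (C i)"
    and feasible: "(\<Inter>i\<in>{1..m}. C i) \<noteq> {}"
begin

text \<open>The set dual to the multiplier \<open>y k i\<close> in the objective after pass \<open>k\<close>; it makes the last block
  one more summand.\<close>

definition cset :: "nat \<Rightarrow> nat \<Rightarrow> 'a set" where
  "cset k i = (if i = m + 1 then H k else C i)"

lemma dual_obj_cset:
  "dual_obj d m C (H k) v
    = ereal (1/2 * (norm (d - (\<Sum>i=1..m+1. v i)))\<^sup>2) + (\<Sum>i=1..m+1. support_fun (v i) (cset k i))"
proof -
  have "(\<Sum>i=1..m. support_fun (v i) (cset k i)) = (\<Sum>i=1..m. support_fun (v i) (C i))"
    by (intro sum.cong) (auto simp: cset_def)
  then show ?thesis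
    by (simp add: dual_obj_def cset_def add.assoc)
qed

lemmas last_block_simps = z_last[folded Suc_eq_plus1] x_last[folded Suc_eq_plus1]
  y_last[folded Suc_eq_plus1] H_step[folded Suc_eq_plus1]

lemma C_nonempty: "i \<in> {1..m} \<Longrightarrow> C i \<noteq> {}"
  using feasible by blast

lemma K_nonempty: "k \<ge> 1 \<Longrightarrow> K k \<noteq> {}"
  using feasible K_lower by blast

lemma K_subset_H:
  assumes "k \<ge> 1"
  shows "K k \<subseteq> H k"
  using proj_variational[OF K_closed K_convex K_nonempty] assms
  by (auto simp: last_block_simps)

lemma inner_step:
  assumes "k \<ge> 1" "i \<in> {1..m+1}"
  shows "y k i - y (k - 1) i = x k (i - 1) - x k i"
proof (cases "i = m + 1")
  case True
  then show ?thesis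
    using assms by (simp add: last_block_simps)
next
  case False
  then show ?thesis
    using assms y_step[of k i] z_step[of k i] by simp
qed

text \<open>For \<open>i = m + 1\<close> this is where \<open>K k \<subseteq> H (k - 1)\<close> enters.\<close>

lemma x_in_previous_cset:
  assumes "k \<ge> 1" "i \<in> {1..m+1}"
  shows "x k i \<in> cset (k - 1) i"
proof (cases "i = m + 1")
  case True
  then show ?thesis
    using assms K_upper[OF assms(1)] proj_in[OF K_closed K_convex K_nonempty]
    by (auto simp: cset_def last_block_simps)
next
  case False
  then show ?thesis
    using assms proj_in[OF C_closed C_convex C_nonempty, of i]
    by (auto simp: cset_def x_step)
qed

text \<open>The multiplier \<open>y k i\<close> is normal at \<open>x k i\<close>: for \<open>i \<le> m\<close> by the variational inequality, and for
  the last block by construction, since \<open>H k\<close> is the halfspace with that normal through that point.\<close>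

lemma support_fun_new_multiplier:
  assumes "k \<ge> 1" "i \<in> {1..m+1}"
  shows "support_fun (y k i) (cset k i) = ereal (y k i \<bullet> x k i)"
proof (cases "i = m + 1")
  case True
  then show ?thesis
    using assms by (intro support_fun_eq_at_normal_point) (auto simp: cset_def last_block_simps)
next
  case False
  then have "i \<in> {1..m}"
    using assms by auto
  then show ?thesis
    using assms False proj_in[OF C_closed C_convex C_nonempty, of i]
      proj_variational[OF C_closed C_convex C_nonempty, of i]
    by (intro support_fun_eq_at_normal_point) (auto simp: cset_def x_step y_step)
qed

lemma x_last_eq_residual: "x k (m + 1) = d - (\<Sum>i=1..m+1. y k i)"
proof (induction k)
  case 0
  show ?case by (rule x_init)
next
  case (Suc k)
  have "(\<Sum>i=1..m+1. y (Suc k) i - y k i) = (\<Sum>i=1..m+1. x (Suc k) (i - 1) - x (Suc k) i)"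
    using inner_step[of "Suc k"] by (intro sum.cong) auto
  also have "\<dots> = x (Suc k) 0 - x (Suc k) (m + 1)"
    using sum_telescope''[of 0 "m + 1" "\<lambda>i. - x (Suc k) i"]
    by (simp add: atLeastSucAtMost_greaterThanAtMost flip: Suc_eq_plus1)
  also have "x (Suc k) 0 = d - (\<Sum>i=1..m+1. y k i)"
    using x_start[of "Suc k"] Suc.IH by simp
  finally show ?case
    by (simp only: sum_subtractf) (simp add: algebra_simps)
qed

lemma pass_balance:
  assumes "k \<ge> 1"
  shows "1/2 * (norm (x (k - 1) (m + 1)))\<^sup>2 + (\<Sum>i=1..m+1. y (k - 1) i \<bullet> x k i)
    = 1/2 * (norm (x k (m + 1)))\<^sup>2 + (\<Sum>i=1..m+1. y k i \<bullet> x k i)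
      + 1/2 * (\<Sum>i=1..m+1. (norm (y k i - y (k - 1) i))\<^sup>2)"
proof -
  let ?N = "\<lambda>i. 1/2 * (norm (x k i))\<^sup>2"
  have balance: "y (k - 1) i \<bullet> x k i - y k i \<bullet> x k i - 1/2 * (norm (y k i - y (k - 1) i))\<^sup>2
      = ?N i - ?N (i - 1)" if "i \<in> {1..m+1}" for i
  proof -
    define e where "e = y k i - y (k - 1) i"
    have "x k (i - 1) = x k i + e" "y k i = y (k - 1) i + e"
      using inner_step[OF assms that] by (simp_all add: e_def algebra_simps)
    then show ?thesis
      unfolding \<open>x k (i - 1) = _\<close> \<open>y k i = _\<close>
      by (simp add: power2_norm_eq_inner algebra_simps inner_commute)
  qed
  have "(\<Sum>i=1..m+1. y (k - 1) i \<bullet> x k i - y k i \<bullet> x k i - 1/2 * (norm (y k i - y (k - 1) i))\<^sup>2)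
      = (\<Sum>i=1..m+1. ?N i - ?N (i - 1))"
    using balance by (intro sum.cong) auto
  also have "\<dots> = ?N (m + 1) - ?N 0"
    using sum_telescope''[of 0 "m + 1" ?N]
    by (simp add: atLeastSucAtMost_greaterThanAtMost flip: Suc_eq_plus1)
  finally show ?thesis
    using x_start[OF assms] by (simp only: sum_subtractf flip: sum_distrib_left)
qed

text \<open>The finite value that the dual objective takes once all its support functions are attained.\<close>

definition attained_value :: "nat \<Rightarrow> real" where
  "attained_value k = 1/2 * (norm (x k (m + 1)))\<^sup>2 + (\<Sum>i=1..m+1. y k i \<bullet> x k i)"

lemma dual_obj_eq_attained_value:
  assumes "k \<ge> 1"
  shows "dual_obj d m C (H k) (y k) = ereal (attained_value k)"
proof -
  have "(\<Sum>i=1..m+1. support_fun (y k i) (cset k i)) = (\<Sum>i=1..m+1. ereal (y k i \<bullet> x k i))"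
    using support_fun_new_multiplier[OF assms] by (intro sum.cong) auto
  then show ?thesis
    unfolding dual_obj_cset attained_value_def x_last_eq_residual by (simp only: sum_ereal plus_ereal.simps)
qed

lemma dual_descent:
  assumes "k \<ge> 1"
  shows "dual_obj d m C (H k) (y k) + ereal (1/2 * (\<Sum>i=1..m+1. (norm (y k i - y (k - 1) i))\<^sup>2))
    \<le> dual_obj d m C (H (k - 1)) (y (k - 1))"
proof -
  have "dual_obj d m C (H k) (y k) + ereal (1/2 * (\<Sum>i=1..m+1. (norm (y k i - y (k - 1) i))\<^sup>2))
      = ereal (1/2 * (norm (x (k - 1) (m + 1)))\<^sup>2) + (\<Sum>i=1..m+1. ereal (y (k - 1) i \<bullet> x k i))"
    unfolding dual_obj_eq_attained_value[OF assms] attained_value_def sum_ereal plus_ereal.simps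
    by (simp only: pass_balance[OF assms])
  also have "\<dots> \<le> dual_obj d m C (H (k - 1)) (y (k - 1))"
    unfolding dual_obj_cset x_last_eq_residual
    by (intro add_mono sum_mono support_fun_ge x_in_previous_cset assms order_refl)
  finally show ?thesis .
qed

lemma attained_value_bounded_below: "\<exists>L. \<forall>k\<ge>1. L \<le> attained_value k"
proof -
  obtain c where c: "c \<in> (\<Inter>i\<in>{1..m}. C i)"
    using feasible by blast
  have "d \<bullet> c - 1/2 * (norm c)\<^sup>2 \<le> attained_value k" if "k \<ge> 1" for k
  proof -
    have "c \<in> H k"
      using c K_lower[OF that] K_subset_H[OF that] by blast
    then show ?thesis
      using dual_obj_ge[of m c C "H k" d "y k"] c by (simp add: dual_obj_eq_attained_value[OF that])
  qed
  then show ?thesis by blast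
qed

lemma summable_dual_steps: "summable (\<lambda>j. \<Sum>i=1..m+1. (norm (y (Suc j) i - y j i))\<^sup>2)"
proof -
  define e where "e j = (\<Sum>i=1..m+1. (norm (y (Suc j) i - y j i))\<^sup>2)" for j
  obtain L where L: "\<And>k. k \<ge> 1 \<Longrightarrow> L \<le> attained_value k"
    using attained_value_bounded_below by blast
  have descent: "e (Suc j) \<le> 2 * attained_value (Suc j) - 2 * attained_value (Suc (Suc j))" for j
  proof -
    have "attained_value (Suc (Suc j)) + 1/2 * e (Suc j) \<le> attained_value (Suc j)"
      using dual_descent[of "Suc (Suc j)"] by (simp add: dual_obj_eq_attained_value e_def)
    then show ?thesis
      by simp
  qed
  have "summable (\<lambda>j. e (Suc j))"
  proof (rule summableI_nonneg_bounded)
    show "0 \<le> e (Suc j)" for j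
      unfolding e_def by (intro sum_nonneg) simp
    have "(\<Sum>j<n. e (Suc j)) \<le> 2 * attained_value 1 - 2 * attained_value (Suc n)" for n
    proof (induction n)
      case (Suc n)
      then show ?case
        using descent[of n] by simp
    qed simp
    then show "(\<Sum>j<n. e (Suc j)) \<le> 2 * attained_value 1 - 2 * L" for n
      using L[of "Suc n"] by (smt (verit) le_add1 plus_1_eq_Suc)
  qed
  then show ?thesis
    unfolding summable_Suc_iff by (simp only: e_def[abs_def])
qed

end

theorem theorem3p4:
  fixes d :: "'a::{real_inner, complete_space}"
    and m :: nat
    and C K H :: "nat \<Rightarrow> 'a set"
    and x y z :: "nat \<Rightarrow> nat \<Rightarrow> 'a"
  assumes "m \<ge> 1"
    and "\<And>i. i \<in> {1..m} \<Longrightarrow> closed (C i)"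
    and "\<And>i. i \<in> {1..m} \<Longrightarrow> convex (C i)"
    and "(\<Inter>i\<in>{1..m}. C i) \<noteq> {}"
    and "extended_dykstra d m C K H x y z"
  shows "(\<forall>k\<ge>1. dual_obj d m C (H (k - 1)) (y (k - 1)) \<ge>
            dual_obj d m C (H k) (y k)
              + ereal (1/2 * (\<Sum>i=1..m+1. (norm (y k i - y (k - 1) i))\<^sup>2)))
       \<and> summable (\<lambda>j. \<Sum>i=1..m+1. (norm (y (Suc j) i - y j i))\<^sup>2)"
proof -
  interpret extended_dykstra d m C K H x y z
    by (rule assms(5))
  interpret feasible_dykstra d m C K H x y z
    using assms(2-4) by unfold_locales auto
  show ?thesis
    using dual_descent summable_dual_steps by blast
qed

end
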